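(* The measure algebra $\mathbb{R}(\omega)$ has the weak Freese-Nation property if and only if $(\mathcal{P}(\omega),\subseteq)$ has the weak Freese-Nation property.
   Context: A quasi-ordering $(P,\leq)$ has the weak Freese-Nation property if there is a mapping $f:P\to[P]^{\leq\aleph_0}$ (assigning to each element of $P$ a countable subset of $P$) such that for all $p,q\in P$ with $p\leq q$ there is $r\in f(p)\cap f(q)$ with $p\leq r\leq q$. A Boolean algebra has the property if it does with respect to its Boolean ordering. $\mathbb{R}(\omega)$ denotes the complete Boolean algebra $\mathrm{Borel}({}^{\omega}2)/\mathrm{null}({}^{\omega}2)$, where ${}^{\omega}2$ is the Cantor space with its usual product measure. *)

theory Defs
  imports "HOL-Probability.Probability"
begin

text \<open>
  The carrier \<open>P\<close> and the relation \<open>le\<close> are explicit parameters; the notion is meant for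
  relations \<open>le\<close> that are reflexive and transitive on \<open>P\<close>. The predicate \<open>countable\<close>
  includes finite sets, so that \<open>f\<close> takes values in the subsets of \<open>P\<close> of cardinality at
  most \<open>\<aleph>\<^sub>0\<close>.
\<close>

definition weak_Freese_Nation :: "'a set \<Rightarrow> ('a \<Rightarrow> 'a \<Rightarrow> bool) \<Rightarrow> bool" where
  "weak_Freese_Nation P le \<longleftrightarrow>
    (\<exists>f :: 'a \<Rightarrow> 'a set.
      (\<forall>p\<in>P. f p \<subseteq> P \<and> countable (f p)) \<and>
      (\<forall>p\<in>P. \<forall>q\<in>P. le p q \<longrightarrow> (\<exists>r \<in> f p \<inter> f q. le p r \<and> le r q)))"

definition cantor_measure :: "(nat \<Rightarrow> bool) measure" where
  "cantor_measure = (\<Pi>\<^sub>M i\<in>UNIV. measure_pmf (bernoulli_pmf (1/2)))"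

text \<open>
  The type \<^typ>\<open>nat \<Rightarrow> bool\<close> carries the product of the discrete topologies on \<^typ>\<open>bool\<close>.
  Its Borel sets are exactly the measurable sets of \<open>cantor_measure\<close>, which is the product
  measure without completion.
\<close>

instance bool :: second_countable_topology
proof
  have "open = generate_topology (UNIV :: bool set set)"
    by (auto simp: fun_eq_iff Topological_Spaces.open_discrete intro: generate_topology.Basis)
  then show "\<exists>B :: bool set set. countable B \<and> open = generate_topology B"
    by (intro exI[of _ UNIV]) (simp add: countable_finite)
qed

lemma sets_cantor_measure: "sets cantor_measure = sets borel"
proof -
  have "sets (borel :: bool measure) = UNIV"
    by (auto intro: borel_open Topological_Spaces.open_discrete)
  then have "sets cantor_measure = sets (\<Pi>\<^sub>M i\<in>(UNIV :: nat set). (borel :: bool measure))"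
    unfolding cantor_measure_def by (intro sets_PiM_cong) auto
  then show ?thesis
    by (simp add: sets_PiM_equal_borel)
qed

definition eq_mod_null :: "(nat \<Rightarrow> bool) set \<Rightarrow> (nat \<Rightarrow> bool) set \<Rightarrow> bool" where
  "eq_mod_null A B \<longleftrightarrow>
    A \<in> sets borel \<and> B \<in> sets borel \<and> (A - B) \<union> (B - A) \<in> null_sets cantor_measure"

lemma null_subset:
  assumes "N \<in> null_sets cantor_measure" "A \<in> sets borel" "A \<subseteq> N"
  shows "A \<in> null_sets cantor_measure"
  using null_sets_subset[OF assms(1) _ assms(3)] assms(2) by (simp add: sets_cantor_measure)

lemma eq_mod_null_iff:
  "eq_mod_null A B \<longleftrightarrow> A \<in> sets borel \<and> B \<in> sets borel \<and>
    A - B \<in> null_sets cantor_measure \<and> B - A \<in> null_sets cantor_measure"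
  unfolding eq_mod_null_def by (blast intro: null_subset)

lemma null_diff_trans:
  assumes "A - B \<in> null_sets cantor_measure" "B - C \<in> null_sets cantor_measure"
    "A \<in> sets borel" "C \<in> sets borel"
  shows "A - C \<in> null_sets cantor_measure"
  by (rule null_subset[OF null_sets.Un[OF assms(1,2)]]) (use assms in auto)

text \<open>
  \<open>eq_mod_null\<close> relates only Borel sets, hence \<open>partial\<close>: the elements of the type are the
  equivalence classes of Borel sets.
\<close>

quotient_type measure_algebra = "(nat \<Rightarrow> bool) set" / partial: eq_mod_null
proof (rule part_equivpI)
  show "\<exists>A. eq_mod_null A A" by (rule exI[of _ "{}"]) (simp add: eq_mod_null_def)
  show "symp eq_mod_null" by (auto simp: symp_def eq_mod_null_iff)
  show "transp eq_mod_null"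
    unfolding transp_def eq_mod_null_iff by (blast intro: null_diff_trans)
qed

instantiation measure_algebra :: boolean_algebra
begin

lift_definition less_eq_measure_algebra :: "measure_algebra \<Rightarrow> measure_algebra \<Rightarrow> bool"
  is "\<lambda>A B. A - B \<in> null_sets cantor_measure"
  unfolding eq_mod_null_iff by (blast intro: null_diff_trans)

definition less_measure_algebra :: "measure_algebra \<Rightarrow> measure_algebra \<Rightarrow> bool" where
  "less_measure_algebra a b \<longleftrightarrow> a \<le> b \<and> \<not> b \<le> a"

lift_definition inf_measure_algebra :: "measure_algebra \<Rightarrow> measure_algebra \<Rightarrow> measure_algebra"
  is "(\<inter>)"
  subgoal for A A' B B'
    unfolding eq_mod_null_iff
    by (auto intro: null_subset[of "A - A'"] null_subset[of "(A - A') \<union> (B - B')"]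
        null_subset[of "(A' - A) \<union> (B' - B)"])
  done

lift_definition sup_measure_algebra :: "measure_algebra \<Rightarrow> measure_algebra \<Rightarrow> measure_algebra"
  is "(\<union>)"
  subgoal for A A' B B'
    unfolding eq_mod_null_iff
    by (auto intro: null_subset[of "(A - A') \<union> (B - B')"]
        null_subset[of "(A' - A) \<union> (B' - B)"])
  done

lift_definition bot_measure_algebra :: measure_algebra is "{}"
  by (simp add: eq_mod_null_def)

lift_definition top_measure_algebra :: measure_algebra is UNIV
  by (simp add: eq_mod_null_def)

lift_definition uminus_measure_algebra :: "measure_algebra \<Rightarrow> measure_algebra" is uminus
  unfolding eq_mod_null_iff by (auto simp: Diff_eq Int_commute)

lift_definition minus_measure_algebra :: "measure_algebra \<Rightarrow> measure_algebra \<Rightarrow> measure_algebra"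
  is "(-)"
  subgoal for A A' B B'
    unfolding eq_mod_null_iff
    by (auto intro: null_subset[of "(A - A') \<union> (B' - B)"]
        null_subset[of "(A' - A) \<union> (B - B')"])
  done

instance
proof
  fix a b c :: measure_algebra
  show "a < b \<longleftrightarrow> a \<le> b \<and> \<not> b \<le> a" by (rule less_measure_algebra_def)
  show "a \<le> a" by transfer simp
  show "a \<le> b \<Longrightarrow> b \<le> c \<Longrightarrow> a \<le> c"
    by transfer (auto simp: eq_mod_null_iff intro: null_diff_trans)
  show "a \<le> b \<Longrightarrow> b \<le> a \<Longrightarrow> a = b" by transfer (simp add: eq_mod_null_iff)
  show "inf a b \<le> a" by transfer (simp add: Diff_eq_empty_iff[THEN iffD2])
  show "inf a b \<le> b" by transfer (simp add: Diff_eq_empty_iff[THEN iffD2])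
  show "a \<le> b \<Longrightarrow> a \<le> c \<Longrightarrow> a \<le> inf b c"
    by transfer (simp add: Diff_Int null_sets.Un)
  show "a \<le> sup a b" by transfer (simp add: Diff_eq_empty_iff[THEN iffD2])
  show "b \<le> sup a b" by transfer (simp add: Diff_eq_empty_iff[THEN iffD2])
  show "b \<le> a \<Longrightarrow> c \<le> a \<Longrightarrow> sup b c \<le> a"
    by transfer (simp add: Un_Diff null_sets.Un)
  show "bot \<le> a" by transfer simp
  show "a \<le> top" by transfer simp
  show "sup a (inf b c) = inf (sup a b) (sup a c)"
    by transfer (simp add: eq_mod_null_iff Un_Int_distrib)
  show "inf a (- a) = bot" by transfer (simp add: eq_mod_null_iff)
  show "sup a (- a) = top" by transfer (simp add: eq_mod_null_iff)
  show "a - b = inf a (- b)" by transfer (simp add: eq_mod_null_iff Diff_eq)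
qed

end

end

theory Submission
  imports Defs
begin

text \<open>
  Each of the two orders is an order retract of the other, and the weak Freese-Nation property
  is inherited by order retracts (\<open>weak_Freese_Nation_retract\<close>): interpolants are computed in the
  larger order and retracted.

  To see the power set of \<open>\<omega>\<close> as a retract of the measure algebra, choose pairwise disjoint Borel
  sets \<open>A 0, A 1, \<dots>\<close> of positive measure. A set \<open>X\<close> is sent to the class of the union of the
  \<open>A n\<close> with \<open>n \<in> X\<close>, and an element \<open>b\<close> is sent back to the set of all \<open>n\<close> for which the class of
  \<open>A n\<close> lies below \<open>b\<close>.

  For the converse, the measure algebra embeds into the power set of a countable set: \<open>b\<close> is
  sent to the set of all pairs of a clopen set \<open>S\<close> and a rational \<open>q\<close> such that the part of \<open>b\<close>
  inside \<open>S\<close> has measure greater than \<open>q\<close>. This reflects the order because, when \<open>b\<close> is not below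
  \<open>c\<close>, a clopen set close to the difference of \<open>b\<close> and \<open>c\<close> contains more of \<open>b\<close> than of \<open>c\<close>
  (\<open>mass_in_separates\<close>). An order embedding \<open>e\<close> of a complete lattice into a power set
  has a monotone left inverse: send \<open>X\<close> to the supremum of all \<open>b\<close> with \<open>e b \<subseteq> X\<close>. The measure algebra is complete
  (\<open>measure_algebra_complete\<close>) because finiteness of the measure reduces arbitrary suprema to
  countable ones.
\<close>
section \<open>Order retracts\<close>

text \<open>
  If \<open>p \<le> p'\<close> then some \<open>s\<close> in both countable sets attached to \<open>e p\<close> and \<open>e p'\<close> lies between
  these two; monotonicity of \<open>r\<close> puts \<open>r s\<close> between \<open>r (e p) = p\<close> and \<open>r (e p') = p'\<close>.
\<close>
lemma weak_Freese_Nation_retract: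
  assumes wfn: "weak_Freese_Nation Q leQ"
    and e: "\<And>p. p \<in> P \<Longrightarrow> e p \<in> Q"
    and e_mono: "\<And>p p'. p \<in> P \<Longrightarrow> p' \<in> P \<Longrightarrow> leP p p' \<Longrightarrow> leQ (e p) (e p')"
    and r: "\<And>q. q \<in> Q \<Longrightarrow> r q \<in> P"
    and r_mono: "\<And>q q'. q \<in> Q \<Longrightarrow> q' \<in> Q \<Longrightarrow> leQ q q' \<Longrightarrow> leP (r q) (r q')"
    and re: "\<And>p. p \<in> P \<Longrightarrow> r (e p) = p"
  shows "weak_Freese_Nation P leP"
proof -
  obtain f where f: "\<And>q. q \<in> Q \<Longrightarrow> f q \<subseteq> Q \<and> countable (f q)"
    and interp: "\<And>q q'. q \<in> Q \<Longrightarrow> q' \<in> Q \<Longrightarrow> leQ q q' \<Longrightarrow>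
      \<exists>s \<in> f q \<inter> f q'. leQ q s \<and> leQ s q'"
    using wfn unfolding weak_Freese_Nation_def by metis
  define g where "g p = r ` f (e p)" for p
  have "g p \<subseteq> P \<and> countable (g p)" if "p \<in> P" for p
    using f[OF e[OF that]] r unfolding g_def by auto
  moreover have "\<exists>s \<in> g p \<inter> g p'. leP p s \<and> leP s p'"
    if p: "p \<in> P" "p' \<in> P" "leP p p'" for p p'
  proof -
    obtain s where s: "s \<in> f (e p)" "s \<in> f (e p')" "leQ (e p) s" "leQ s (e p')"
      using interp[OF e[OF p(1)] e[OF p(2)] e_mono[OF p]] by auto
    then have "s \<in> Q" using f[OF e[OF p(1)]] by auto
    then have "leP p (r s)" "leP (r s) p'"
      using r_mono[OF e[OF p(1)] _ s(3)] r_mono[OF _ e[OF p(2)] s(4)] re p by auto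
    then show ?thesis using s unfolding g_def by auto
  qed
  ultimately show ?thesis unfolding weak_Freese_Nation_def by (intro exI[of _ g]) auto
qed

text \<open>
  A sequence of up-sets amounts to a monotone map \<open>b \<mapsto> {n. b \<in> U n}\<close> into the power set of
  \<open>\<omega>\<close>, and separation says that this map reflects the order. Completeness supplies the
  retraction.
\<close>
lemma weak_Freese_Nation_if_separating_upsets:
  fixes U :: "nat \<Rightarrow> 'a::order set"
  assumes wfn: "weak_Freese_Nation (Pow (UNIV :: nat set)) (\<subseteq>)"
    and upset: "\<And>n b c. b \<in> U n \<Longrightarrow> b \<le> c \<Longrightarrow> c \<in> U n"
    and separates: "\<And>b c. \<not> b \<le> c \<Longrightarrow> \<exists>n. b \<in> U n \<and> c \<notin> U n"
    and complete: "\<And>S :: 'a set. \<exists>s. (\<forall>a\<in>S. a \<le> s) \<and> (\<forall>u. (\<forall>a\<in>S. a \<le> u) \<longrightarrow> s \<le> u)"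
  shows "weak_Freese_Nation (UNIV :: 'a set) (\<le>)"
proof -
  define e where "e b = {n. b \<in> U n}" for b
  define lub where
    "lub S = (SOME s. (\<forall>a\<in>S. a \<le> s) \<and> (\<forall>u. (\<forall>a\<in>S. a \<le> u) \<longrightarrow> s \<le> u))" for S :: "'a set"
  note lub = someI_ex[OF complete, folded lub_def]
  have ub: "a \<le> lub S" if "a \<in> S" for S a
    using lub[of S] that by (elim conjE) (rule bspec)
  have least: "lub S \<le> u" if "\<And>a. a \<in> S \<Longrightarrow> a \<le> u" for S u
    using lub[of S] that by simp
  have e_le: "e b \<subseteq> e c \<longleftrightarrow> b \<le> c" for b c
  proof
    show "e b \<subseteq> e c" if "b \<le> c" using upset[OF _ that] unfolding e_def by auto
    show "b \<le> c" if "e b \<subseteq> e c" using separates[of b c] that unfolding e_def by auto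
  qed
  show ?thesis
  proof (rule weak_Freese_Nation_retract[OF wfn, where e = e and r = "\<lambda>X. lub {b. e b \<subseteq> X}"])
    show "lub {b. e b \<subseteq> X} \<le> lub {b. e b \<subseteq> Y}" if "X \<subseteq> Y" for X Y
      using that by (intro least ub) auto
    show "lub {b. e b \<subseteq> e p} = p" for p
      by (intro order_antisym least ub) (auto simp: e_le)
  qed (auto simp: e_le)
qed

section \<open>Finite measure spaces\<close>

text \<open>
  The measures of unions of countable subfamilies are bounded, and their supremum is attained,
  since countably many countable subfamilies can be merged. A member of \<open>F\<close> that is not almost
  covered by a maximal union would enlarge its measure.
\<close>
lemma (in finite_measure) countable_exhaustion:
  assumes F: "F \<subseteq> sets M"
  obtains C where "C \<subseteq> F" "countable C" "\<And>A. A \<in> F \<Longrightarrow> A - \<Union>C \<in> null_sets M"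
proof -
  define T where "T = {C. C \<subseteq> F \<and> countable C}"
  define t where "t = (SUP C\<in>T. measure M (\<Union>C))"
  have sets: "\<Union>C \<in> sets M" if "C \<in> T" for C
    using that F unfolding T_def by (auto intro!: sets.countable_Union)
  have bdd: "bdd_above ((\<lambda>C. measure M (\<Union>C)) ` T)"
    by (rule bdd_aboveI2[of _ _ "measure M (space M)"]) (rule bounded_measure)
  have "{} \<in> T" unfolding T_def by simp
  have "\<exists>C\<in>T. t - 1 / Suc n < measure M (\<Union>C)" for n
    using less_cSUP_iff[OF _ bdd, of "t - 1 / Suc n"] \<open>{} \<in> T\<close> unfolding t_def by auto
  then obtain C where C: "\<And>n. C n \<in> T" "\<And>n. t - 1 / Suc n < measure M (\<Union>(C n))"
    by metis
  define D where "D = (\<Union>n. C n)"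
  have D: "D \<in> T" using C(1) unfolding D_def T_def by auto
  have t_le: "t \<le> measure M (\<Union>D)"
  proof (rule field_le_epsilon)
    fix e :: real assume "0 < e"
    then obtain n where "1 / Suc n < e" using nat_approx_posE by metis
    moreover have "measure M (\<Union>(C n)) \<le> measure M (\<Union>D)"
      by (rule finite_measure_mono[OF _ sets[OF D]]) (auto simp: D_def)
    ultimately show "t \<le> measure M (\<Union>D) + e" using C(2)[of n] by simp
  qed
  have "A - \<Union>D \<in> null_sets M" if A: "A \<in> F" for A
  proof -
    have "insert A D \<in> T" using A D unfolding T_def by auto
    then have "measure M (\<Union>(insert A D)) \<le> measure M (\<Union>D)"
      using cSUP_upper[OF _ bdd, of "insert A D"] t_le unfolding t_def by simp
    moreover have "measure M (\<Union>(insert A D)) = measure M (\<Union>D) + measure M (A - \<Union>D)"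
      using finite_measure_Union'[of "\<Union>D" A] sets[OF D] A F by (auto simp: Un_commute)
    ultimately have "measure M (A - \<Union>D) = 0" using measure_nonneg[of M "A - \<Union>D"] by linarith
    then show ?thesis using sets[OF D] A F by (auto simp: null_sets_def emeasure_eq_measure)
  qed
  with D show ?thesis using that unfolding T_def by blast
qed

text \<open>
  The sets that can be approximated form a \<open>\<sigma>\<close>-algebra. In a countable union, continuity from
  below makes a finite partial union carry all but \<open>e / 2\<close> of the measure; the other \<open>e / 2\<close> is
  shared among approximations of its finitely many members.
\<close>
lemma (in finite_measure) approx_by_generating_algebra:
  assumes "algebra (space M) G" and gen: "sets M = sigma_sets (space M) G"
    and "A \<in> sets M" "0 < e"
  obtains S where "S \<in> G" "measure M (sym_diff A S) < e"
proof -
  interpret G: algebra "space M" G by fact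
  have G: "S \<in> sets M" if "S \<in> G" for S using that gen by auto
  have "A \<in> sigma_sets (space M) G" using assms by simp
  then have "\<forall>e>0. \<exists>S\<in>G. measure M (sym_diff A S) < e"
  proof (induction A rule: sigma_sets.induct)
    case (Basic A)
    then show ?case by (auto intro!: bexI[of _ A])
  next
    case Empty
    then show ?case by (auto intro!: bexI[of _ "{}"])
  next
    case (Compl A)
    have "sym_diff (space M - A) (space M - S) = sym_diff A S" if "S \<in> G" for S
      using that Compl.hyps G[THEN sets.sets_into_space] gen
        sets.sets_into_space[of A M] by blast
    then show ?case using Compl.IH G.compl_sets by metis
  next
    case (Union A)
    show ?case
    proof (intro allI impI)
      fix e :: real assume e: "0 < e"
      have A: "A i \<in> sets M" for i using Union.hyps gen by simp
      define B where "B n = (\<Union>i<n. A i)" for n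
      have B: "B n \<in> sets M" for n unfolding B_def using A by auto
      have "incseq B" unfolding B_def incseq_def by (auto intro: less_le_trans)
      then have "(\<lambda>n. measure M (B n)) \<longlonglongrightarrow> measure M (\<Union>n. B n)"
        using B by (intro finite_Lim_measure_incseq) auto
      moreover have UB: "(\<Union>n. B n) = (\<Union>i. A i)" unfolding B_def by auto
      ultimately obtain n where n: "dist (measure M (B n)) (measure M (\<Union>i. A i)) < e / 2"
        using LIMSEQ_D[of _ _ "e / 2"] e unfolding dist_norm
        by (metis half_gt_zero order_refl)
      have tail: "measure M ((\<Union>i. A i) - B n) < e / 2"
      proof -
        have "measure M ((\<Union>i. A i) - B n) = measure M (\<Union>i. A i) - measure M (B n)"
          using A B by (intro finite_measure_Diff) (auto simp: UB[symmetric])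
        then show ?thesis using n unfolding dist_real_def by linarith
      qed
      \<comment> \<open>The denominator uses \<open>Suc n\<close>, as \<open>n\<close> may be \<open>0\<close>.\<close>
      have "\<exists>S\<in>G. measure M (sym_diff (A i) S) < e / (2 * Suc n)" for i
        using Union.IH[of i] e by simp
      then obtain S where S: "\<And>i. S i \<in> G"
          "\<And>i. measure M (sym_diff (A i) (S i)) < e / (2 * Suc n)"
        by metis
      have US: "(\<Union>i<n. S i) \<in> G" using S(1) by (intro G.finite_UN) auto
      have sd: "sym_diff (A i) (S i) \<in> sets M" for i using A S(1) G by auto
      have "measure M (sym_diff (\<Union>i. A i) (\<Union>i<n. S i))
          \<le> measure M (((\<Union>i. A i) - B n) \<union> (\<Union>i<n. sym_diff (A i) (S i)))"
        using A B sd by (intro finite_measure_mono) (auto simp: B_def)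
      also have "\<dots> \<le> measure M ((\<Union>i. A i) - B n) + measure M (\<Union>i<n. sym_diff (A i) (S i))"
        using A B sd by (intro measure_Un_le) auto
      also have "measure M (\<Union>i<n. sym_diff (A i) (S i)) \<le> (\<Sum>i<n. measure M (sym_diff (A i) (S i)))"
        using sd by (intro finite_measure_subadditive_finite) auto
      also have "\<dots> \<le> (\<Sum>i<n. e / (2 * Suc n))"
        using S(2) by (intro sum_mono less_imp_le)
      also have "\<dots> \<le> e / 2" using e by (simp add: field_simps)
      finally have "measure M (sym_diff (\<Union>i. A i) (\<Union>i<n. S i)) < e"
        using tail by linarith
      with US show "\<exists>S\<in>G. measure M (sym_diff (\<Union>i. A i) S) < e" by blast
    qed
  qed
  with \<open>0 < e\<close> show ?thesis using that by blast
qed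

section \<open>Cantor space\<close>

text \<open>
  Formal Boolean combinations of coordinates: a countable syntax for the clopen sets of Cantor
  space, so that the algebra they form is enumerated without normal forms.
\<close>
datatype clopen_code = Coord nat | Complement clopen_code | Join clopen_code clopen_code

instance clopen_code :: countable by countable_datatype

primrec clopen :: "clopen_code \<Rightarrow> (nat \<Rightarrow> bool) set" where
  "clopen (Coord n) = {x. x n}"
| "clopen (Complement c) = - clopen c"
| "clopen (Join c d) = clopen c \<union> clopen d"

interpretation coin: product_prob_space "\<lambda>_. measure_pmf (bernoulli_pmf (1/2))" "UNIV :: nat set"
  by unfold_locales

interpretation cantor: prob_space cantor_measure
  unfolding cantor_measure_def by (rule prob_space_PiM) unfold_locales

lemma space_cantor_measure: "space cantor_measure = UNIV"
  by (simp add: cantor_measure_def space_PiM)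

lemma algebra_clopen: "algebra UNIV (range clopen)"
  unfolding algebra_iff_Un
proof (intro conjI ballI)
  show "{} \<in> range clopen"
    by (rule range_eqI[of _ _ "Complement (Join (Coord 0) (Complement (Coord 0)))"]) auto
  fix A assume "A \<in> range clopen"
  then obtain c where c: "A = clopen c" by blast
  show "UNIV - A \<in> range clopen"
    by (rule range_eqI[of _ _ "Complement c"]) (auto simp: c)
  fix B assume "B \<in> range clopen"
  then obtain d where d: "B = clopen d" by blast
  show "A \<union> B \<in> range clopen"
    by (rule range_eqI[of _ _ "Join c d"]) (auto simp: c d)
qed auto

lemma sets_cantor_measure_clopen: "sets cantor_measure = sigma_sets UNIV (range clopen)"
proof -
  interpret algebra UNIV "range clopen" by (rule algebra_clopen)
  have coord: "{x. x i \<in> B} \<in> range clopen" for i and B :: "bool set"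
  proof -
    have "{x. x i} \<in> range clopen"
      by (rule range_eqI[of _ _ "Coord i"]) simp
    moreover from compl_sets[OF this] have "{x. \<not> x i} \<in> range clopen"
      by (simp add: Collect_neg_eq Compl_eq_Diff_UNIV)
    moreover have "{x. x i \<in> B} =
        (if True \<in> B then {x. x i} else {}) \<union> (if False \<in> B then {x. \<not> x i} else {})"
      by (auto) (metis (full_types))+
    ultimately show ?thesis using Un empty_sets by (auto intro!: Un)
  qed
  have "clopen c \<in> sets cantor_measure" for c
  proof (induction c)
    case (Coord n)
    have "(\<lambda>x. x n) -` {True} \<inter> space cantor_measure \<in> sets cantor_measure"
      unfolding cantor_measure_def
      by (rule measurable_sets[OF measurable_component_singleton]) auto
    then show ?case by (simp add: space_cantor_measure vimage_def)
  next
    case (Complement c)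
    then show ?case using sets.compl_sets[OF Complement]
      by (simp add: space_cantor_measure Compl_eq_Diff_UNIV)
  qed auto
  then have "sigma_sets UNIV (range clopen) \<subseteq> sets cantor_measure"
    using sets.sigma_sets_subset[of "range clopen" cantor_measure]
    by (auto simp: space_cantor_measure)
  moreover have "sets cantor_measure \<subseteq> sigma_sets UNIV (range clopen)"
    unfolding cantor_measure_def sets_PiM_single
    using coord by (auto intro!: sigma_sets_mono')
  ultimately show ?thesis by blast
qed

text \<open>
  These cylinders collect the sequences whose first \<open>True\<close> is at position \<open>n\<close>. They are pairwise
  disjoint and serve as the atoms of a copy of the power set of \<open>\<omega>\<close> in the measure algebra.
\<close>
lemma measure_first_True_pos:
  "0 < measure cantor_measure {x. x n \<and> (\<forall>i<n. \<not> x i)}"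
proof -
  have "{x. x n \<and> (\<forall>i<n. \<not> x i)} =
      prod_emb UNIV (\<lambda>_. measure_pmf (bernoulli_pmf (1/2))) {..n} (\<Pi>\<^sub>E i\<in>{..n}. {i = n})"
    by (auto simp: prod_emb_def PiE_def Pi_def restrict_def extensional_def le_less)
  then have "measure cantor_measure {x. x n \<and> (\<forall>i<n. \<not> x i)} =
      (\<Prod>i\<le>n. measure (measure_pmf (bernoulli_pmf (1/2))) {i = n})"
    unfolding cantor_measure_def by (simp add: coin.measure_PiM_emb)
  also have "\<dots> > 0" by (intro prod_pos) (auto simp: measure_pmf_single)
  finally show ?thesis .
qed

section \<open>The measure algebra\<close>

lemma abs_le_abs_iff:
  assumes "A \<in> sets borel" "B \<in> sets borel"
  shows "abs_measure_algebra A \<le> abs_measure_algebra B \<longleftrightarrow> A - B \<in> null_sets cantor_measure"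
  using assms by (intro less_eq_measure_algebra.abs_eq) (auto simp: eq_mod_null_def)

lemma measure_algebra_cases:
  obtains A where "A \<in> sets borel" "b = abs_measure_algebra A"
proof -
  have "\<exists>A. A \<in> sets borel \<and> b = abs_measure_algebra A"
    by (induct b rule: measure_algebra.abs_induct) (auto simp: eq_mod_null_def)
  then show ?thesis using that by blast
qed

text \<open>
  The supremum of \<open>S\<close> is the class of a countable union of representatives that exhausts all
  representatives up to null sets.
\<close>
lemma measure_algebra_complete:
  fixes S :: "measure_algebra set"
  shows "\<exists>s. (\<forall>a\<in>S. a \<le> s) \<and> (\<forall>u. (\<forall>a\<in>S. a \<le> u) \<longrightarrow> s \<le> u)"
proof -
  define F where "F = {A \<in> sets borel. abs_measure_algebra A \<in> S}"
  obtain C where C: "C \<subseteq> F" "countable C"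
      "\<And>A. A \<in> F \<Longrightarrow> A - \<Union>C \<in> null_sets cantor_measure"
    using cantor.countable_exhaustion[of F] by (auto simp: F_def sets_cantor_measure)
  have UC: "\<Union>C \<in> sets borel"
    using C unfolding F_def by (intro sets.countable_Union) auto
  show ?thesis
  proof (intro exI[of _ "abs_measure_algebra (\<Union>C)"] conjI ballI allI impI)
    fix a assume "a \<in> S"
    then show "a \<le> abs_measure_algebra (\<Union>C)"
      using C(3) UC by (cases a rule: measure_algebra_cases) (auto simp: F_def abs_le_abs_iff)
  next
    fix u assume u: "\<forall>a\<in>S. a \<le> u"
    obtain B where B: "B \<in> sets borel" "u = abs_measure_algebra B"
      by (rule measure_algebra_cases)
    have "A - B \<in> null_sets cantor_measure" if "A \<in> C" for A
    proof -
      have "A \<in> sets borel" "abs_measure_algebra A \<le> u"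
        using that C(1) u unfolding F_def by auto
      then show ?thesis using B by (simp add: abs_le_abs_iff)
    qed
    then have "(\<Union>A\<in>C. A - B) \<in> null_sets cantor_measure"
      using C(2) by (intro null_sets_UN') auto
    then show "abs_measure_algebra (\<Union>C) \<le> u"
      using UC B by (simp add: abs_le_abs_iff Diff_eq Int_UN_distrib2)
  qed
qed

lemma clopen_sets: "clopen c \<in> sets borel"
  using sets_cantor_measure_clopen by (auto simp: sets_cantor_measure)

lemma measure_Int_mono_mod_null:
  assumes "A \<in> sets borel" "B \<in> sets borel" "S \<in> sets borel"
    and "A - B \<in> null_sets cantor_measure"
  shows "measure cantor_measure (A \<inter> S) \<le> measure cantor_measure (B \<inter> S)"
proof -
  have "measure cantor_measure (A \<inter> S) \<le> measure cantor_measure ((B \<inter> S) \<union> (A - B))"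
    using assms by (intro cantor.finite_measure_mono) (auto simp: sets_cantor_measure)
  also have "\<dots> = measure cantor_measure (B \<inter> S)"
    using assms by (intro measure_Un_null_set) (auto simp: sets_cantor_measure)
  finally show ?thesis .
qed

lift_definition mass_in :: "clopen_code \<Rightarrow> measure_algebra \<Rightarrow> real"
  is "\<lambda>c A. measure cantor_measure (A \<inter> clopen c)"
  by (auto simp: eq_mod_null_iff clopen_sets intro!: order_antisym measure_Int_mono_mod_null)

lemma mass_in_mono: "a \<le> b \<Longrightarrow> mass_in c a \<le> mass_in c b"
  by transfer (auto simp: eq_mod_null_iff clopen_sets intro!: measure_Int_mono_mod_null)

text \<open>
  Let \<open>D\<close> represent the part of \<open>a\<close> outside \<open>b\<close> and let \<open>S\<close> be a clopen set that differs from
  \<open>D\<close> by less than half of the measure of \<open>D\<close>. More than half of the measure of \<open>D\<close> is then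
  contributed to \<open>S\<close> by \<open>a\<close>, whereas \<open>b\<close> meets \<open>S\<close> only outside \<open>D\<close>, hence in less than half.
\<close>
lemma mass_in_separates:
  assumes "\<not> a \<le> b"
  obtains c where "mass_in c b < mass_in c a"
proof -
  obtain A where A: "A \<in> sets borel" "a = abs_measure_algebra A" by (rule measure_algebra_cases)
  obtain B where B: "B \<in> sets borel" "b = abs_measure_algebra B" by (rule measure_algebra_cases)
  define D where "D = A - B"
  have D: "D \<in> sets cantor_measure" using A B by (simp add: D_def sets_cantor_measure)
  have "D \<notin> null_sets cantor_measure" using assms A B by (simp add: D_def abs_le_abs_iff)
  then have "measure cantor_measure D \<noteq> 0"
    using D by (simp add: null_sets_def cantor.emeasure_eq_measure)
  then have "0 < measure cantor_measure D / 2"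
    using measure_nonneg[of cantor_measure D] by linarith
  then obtain S where "S \<in> range clopen"
      and S: "measure cantor_measure (sym_diff D S) < measure cantor_measure D / 2"
    using cantor.approx_by_generating_algebra[of "range clopen" D] D algebra_clopen
      sets_cantor_measure_clopen space_cantor_measure by metis
  then obtain c where c: "S = clopen c" by blast
  note sets = A(1) B(1) D clopen_sets[of c]
  let ?\<mu> = "measure cantor_measure"
  have "?\<mu> (B \<inter> S) \<le> ?\<mu> (sym_diff D S)"
    using sets by (intro cantor.finite_measure_mono) (auto simp: D_def c sets_cantor_measure)
  moreover have "?\<mu> D \<le> ?\<mu> ((A \<inter> S) \<union> sym_diff D S)"
    using sets by (intro cantor.finite_measure_mono) (auto simp: D_def c sets_cantor_measure)
  moreover have "?\<mu> ((A \<inter> S) \<union> sym_diff D S) \<le> ?\<mu> (A \<inter> S) + ?\<mu> (sym_diff D S)"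
    using sets by (intro measure_Un_le) (auto simp: c sets_cantor_measure)
  ultimately have "?\<mu> (B \<inter> S) < ?\<mu> (A \<inter> S)" using S by linarith
  moreover have "mass_in c a = ?\<mu> (A \<inter> S)" "mass_in c b = ?\<mu> (B \<inter> S)"
    using A B by (auto simp: c eq_mod_null_def intro!: mass_in.abs_eq)
  ultimately show ?thesis using that[of c] by simp
qed

text \<open>
  The rational thresholds turn the countably many functions \<open>mass_in c\<close> into countably many
  up-sets.
\<close>
lemma weak_Freese_Nation_measure_algebra_if_Pow:
  assumes "weak_Freese_Nation (Pow (UNIV :: nat set)) (\<subseteq>)"
  shows "weak_Freese_Nation (UNIV :: measure_algebra set) (\<le>)"
proof (rule weak_Freese_Nation_if_separating_upsets[OF assms])
  define U where "U n = {b. case from_nat n of (c, q :: rat) \<Rightarrow> of_rat q < mass_in c b}" for n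
  show "c \<in> U n" if "b \<in> U n" "b \<le> c" for n b c
    using that mass_in_mono[OF that(2)] unfolding U_def
    by (auto split: prod.splits intro: less_le_trans)
  show "\<exists>n. b \<in> U n \<and> c \<notin> U n" if not_le: "\<not> b \<le> c" for b c
  proof -
    obtain s where "mass_in s c < mass_in s b" using mass_in_separates[OF not_le] .
    then obtain q :: rat where "mass_in s c < of_rat q" "of_rat q < mass_in s b"
      using of_rat_dense by blast
    then show ?thesis unfolding U_def by (intro exI[of _ "to_nat (s, q)"]) auto
  qed
qed (rule measure_algebra_complete)

lemma weak_Freese_Nation_Pow_if_measure_algebra:
  assumes "weak_Freese_Nation (UNIV :: measure_algebra set) (\<le>)"
  shows "weak_Freese_Nation (Pow (UNIV :: nat set)) (\<subseteq>)"
proof -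
  define A :: "nat \<Rightarrow> (nat \<Rightarrow> bool) set" where "A n = {x. x n \<and> (\<forall>i<n. \<not> x i)}" for n
  have A_pos: "0 < measure cantor_measure (A n)" for n
    unfolding A_def by (rule measure_first_True_pos)
  \<comment> \<open>Sets outside the \<open>\<sigma>\<close>-algebra have measure \<open>0\<close> by convention, so positivity yields measurability.\<close>
  have A: "A n \<in> sets borel" for n
    using A_pos[of n] measure_notin_sets[of "A n" cantor_measure]
    by (auto simp: sets_cantor_measure)
  have disjoint: "A m \<inter> A n = {}" if "m \<noteq> n" for m n
    using that unfolding A_def by (auto simp: neq_iff)
  define e where "e X = abs_measure_algebra (\<Union>n\<in>X. A n)" for X
  define r where "r b = {n. abs_measure_algebra (A n) \<le> b}" for b
  have UA: "(\<Union>n\<in>X. A n) \<in> sets borel" for X using A by auto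
  show ?thesis
  proof (rule weak_Freese_Nation_retract[OF assms, where e = e and r = r])
    show "e X \<le> e Y" if "X \<subseteq> Y" for X Y
    proof -
      have diff: "(\<Union>n\<in>X. A n) - (\<Union>n\<in>Y. A n) = {}" using that by auto
      show ?thesis unfolding e_def abs_le_abs_iff[OF UA UA] diff by simp
    qed
    show "r (e X) = X" for X
    proof -
      have "abs_measure_algebra (A n) \<le> e X \<longleftrightarrow> n \<in> X" for n
      proof (cases "n \<in> X")
        case True
        then have diff: "A n - (\<Union>k\<in>X. A k) = {}" by auto
        show ?thesis unfolding e_def abs_le_abs_iff[OF A UA] diff using True by simp
      next
        case False
        have "A n \<inter> A k = {}" if "k \<in> X" for k
          using False that by (intro disjoint) auto
        then have diff: "A n - (\<Union>k\<in>X. A k) = A n" by auto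
        have "A n \<notin> null_sets cantor_measure"
          using A_pos[of n] by (auto simp: null_sets_def measure_def)
        then show ?thesis unfolding e_def abs_le_abs_iff[OF A UA] diff using False by simp
      qed
      then show ?thesis unfolding r_def by simp
    qed
    show "r b \<subseteq> r c" if "b \<le> c" for b c using that unfolding r_def by auto
  qed auto
qed

theorem proposition5p1:
  shows "weak_Freese_Nation (UNIV :: measure_algebra set) (\<le>) \<longleftrightarrow>
    weak_Freese_Nation (Pow (UNIV :: nat set)) (\<subseteq>)"
  using weak_Freese_Nation_measure_algebra_if_Pow weak_Freese_Nation_Pow_if_measure_algebra
  by blast

end
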